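(* Let $k\ge2$ and let points $M_1,\dots,M_N\in\mathbb R^k$ with masses $m_1,\dots,m_N>0$ be given, not all contained in one hyperplane, with total mass $m$. Use Cartesian coordinates $(x_1,\dots,x_k)$ with origin at the center of masses $C$. Consider the family (indexed by $\mu\in\mathbb R$) of ellipsoids $$\langle K_1\beta,\beta\rangle-2\langle b,\beta\rangle+m\beta_0^2+J_{kk}=\mu$$ in the space of parameters $(\beta_0,\beta)$, $\beta=(\beta_1,\dots,\beta_{k-1})$. All ellipsoids from this family have the same center at the point $(0,\hat\beta)$, where $\hat\beta=K_1^{-1}b$, and $(0,\hat\beta)$ are the coordinates of the best fit hyperplane in the direction $Cx_k$. The equation of the family can be rewritten in the form $$\langle K_1(\beta-\hat\beta),\beta-\hat\beta\rangle=\mu+\langle K_1^{-1}b,b\rangle-m\beta_0^2-J_{kk}.$$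
   Context: Write $x^{(i)}_1,\dots,x^{(i)}_k$ for the coordinates of $M_i$ (with origin at the center of masses) and $J_{jl}=\sum_{i=1}^N m_ix_j^{(i)}x_l^{(i)}$ for $1\le j,l\le k$. $K_1=(J_{jl})_{1\le j,l\le k-1}$ and $b=(J_{1k},\dots,J_{k-1\,k})^T$. The parameters $(\beta_0,\beta_1,\dots,\beta_{k-1})$ are the coordinates of the hyperplane $x_k=\beta_0+\beta_1x_1+\dots+\beta_{k-1}x_{k-1}$. The best fit hyperplane in the direction $Cx_k$ is the hyperplane of this form minimizing the directional hyperplanar moment $\sum_{i=1}^N m_i\hat D_i^2$, where $\hat D_i$ is the distance between $M_i$ and the intersection of the hyperplane with the line through $M_i$ parallel to the axis $Cx_k$ (least squares in the direction of $x_k$). The ellipsoids are the members of the family for those $\mu$ for which the solution set contains more than one point. *)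

theory Defs
  imports "HOL-Analysis.Analysis"
begin

text \<open>
  The coordinate indices 1, ..., k are the elements of \<open>'n option\<close>: \<open>Some j\<close> ranges over
  the first k - 1 indices and \<open>None\<close> is the last index k. Hence k = CARD('n) + 1, and k is at
  least 2 because types are nonempty. The points \<open>M i\<close> are arbitrary, for \<open>i \<in> {1..N}\<close>; the
  coordinates in use are those of \<open>M i\<close> relative to the center of masses.
\<close>

definition total_mass :: "nat \<Rightarrow> (nat \<Rightarrow> real) \<Rightarrow> real" where
  "total_mass N m = (\<Sum>i=1..N. m i)"

definition mass_center :: "nat \<Rightarrow> (nat \<Rightarrow> real) \<Rightarrow> (nat \<Rightarrow> 'a::real_vector) \<Rightarrow> 'a" where
  "mass_center N m M = (1 / total_mass N m) *\<^sub>R (\<Sum>i=1..N. m i *\<^sub>R M i)"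

definition central_coords ::
  "nat \<Rightarrow> (nat \<Rightarrow> real) \<Rightarrow> (nat \<Rightarrow> real ^ 'n option) \<Rightarrow> nat \<Rightarrow> real ^ ('n::finite) option" where
  "central_coords N m M i = M i - mass_center N m M"

definition J ::
  "nat \<Rightarrow> (nat \<Rightarrow> real) \<Rightarrow> (nat \<Rightarrow> real ^ 'n option) \<Rightarrow> 'n option \<Rightarrow> ('n::finite) option \<Rightarrow> real" where
  "J N m M j l = (\<Sum>i=1..N. m i * central_coords N m M i $ j * central_coords N m M i $ l)"

definition K1 ::
  "nat \<Rightarrow> (nat \<Rightarrow> real) \<Rightarrow> (nat \<Rightarrow> real ^ 'n option) \<Rightarrow> real ^ 'n ^ ('n::finite)" where
  "K1 N m M = (\<chi> j l. J N m M (Some j) (Some l))"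

definition b_vec ::
  "nat \<Rightarrow> (nat \<Rightarrow> real) \<Rightarrow> (nat \<Rightarrow> real ^ 'n option) \<Rightarrow> real ^ ('n::finite)" where
  "b_vec N m M = (\<chi> j. J N m M (Some j) None)"

definition beta_hat ::
  "nat \<Rightarrow> (nat \<Rightarrow> real) \<Rightarrow> (nat \<Rightarrow> real ^ 'n option) \<Rightarrow> real ^ ('n::finite)" where
  "beta_hat N m M = matrix_inv (K1 N m M) *v b_vec N m M"

definition family ::
  "nat \<Rightarrow> (nat \<Rightarrow> real) \<Rightarrow> (nat \<Rightarrow> real ^ 'n option) \<Rightarrow> real \<Rightarrow> (real \<times> (real ^ ('n::finite))) set" where
  "family N m M \<mu> =
     {(\<beta>\<^sub>0, \<beta>). (K1 N m M *v \<beta>) \<bullet> \<beta> - 2 * (b_vec N m M \<bullet> \<beta>)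
        + total_mass N m * \<beta>\<^sub>0\<^sup>2 + J N m M None None = \<mu>}"

definition ellipsoid_with_center :: "'a::euclidean_space \<Rightarrow> 'a set \<Rightarrow> bool" where
  "ellipsoid_with_center c E \<longleftrightarrow>
     (\<exists>f. linear f \<and> (\<forall>x y. f x \<bullet> y = x \<bullet> f y) \<and> (\<forall>x. x \<noteq> 0 \<longrightarrow> f x \<bullet> x > 0) \<and>
          E = {x. f (x - c) \<bullet> (x - c) = 1})"

text \<open>
  The hyperplane with parameters \<open>(\<beta>\<^sub>0, \<beta>)\<close> in coordinates with origin at \<open>C\<close>, as a set of
  points of the ambient space.
\<close>

definition graph_hyperplane ::
  "real ^ 'n option \<Rightarrow> real \<Rightarrow> real ^ 'n \<Rightarrow> (real ^ ('n::finite) option) set" where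
  "graph_hyperplane C \<beta>\<^sub>0 \<beta> =
     {p. (p - C) $ None = \<beta>\<^sub>0 + (\<Sum>j\<in>UNIV. \<beta> $ j * (p - C) $ Some j)}"

definition last_axis_line :: "real ^ 'n option \<Rightarrow> (real ^ ('n::finite) option) set" where
  "last_axis_line p = {p + t *\<^sub>R axis None 1 | t. True}"

text \<open>
  A hyperplane of the form \<open>graph_hyperplane C \<beta>\<^sub>0 \<beta>\<close> meets each such line in exactly one point;
  for other sets \<open>H\<close> the value of \<open>directional_dist\<close> has no meaning.
\<close>

definition directional_dist :: "(real ^ 'n option) set \<Rightarrow> real ^ ('n::finite) option \<Rightarrow> real" where
  "directional_dist H p = dist p (the_elem (H \<inter> last_axis_line p))"

definition directional_moment ::
  "nat \<Rightarrow> (nat \<Rightarrow> real) \<Rightarrow> (nat \<Rightarrow> real ^ 'n option) \<Rightarrow> (real ^ ('n::finite) option) set \<Rightarrow> real" where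
  "directional_moment N m M H = (\<Sum>i=1..N. m i * (directional_dist H (M i))\<^sup>2)"

definition best_fit_hyperplane ::
  "nat \<Rightarrow> (nat \<Rightarrow> real) \<Rightarrow> (nat \<Rightarrow> real ^ 'n option) \<Rightarrow> (real ^ ('n::finite) option) set \<Rightarrow> bool" where
  "best_fit_hyperplane N m M H \<longleftrightarrow>
     (let \<H> = {graph_hyperplane (mass_center N m M) \<beta>\<^sub>0 \<beta> | \<beta>\<^sub>0 \<beta>. True}
      in H \<in> \<H> \<and> (\<forall>H'\<in>\<H>. directional_moment N m M H \<le> directional_moment N m M H'))"

end

theory Submission
  imports Defs
begin

text \<open>
  Let \<open>R (\<beta>\<^sub>0, \<beta>)\<close> be the left-hand side of the equation of the family. Everything rests on
  the fact that \<open>R\<close> is a sum of squared residuals: because the masses balance around their center,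
  the terms linear in \<open>\<beta>\<^sub>0\<close> cancel and
  \<open>R (\<beta>\<^sub>0, \<beta>) = (\<Sum>i. m\<^sub>i (y\<^sub>i - \<beta>\<^sub>0 - \<beta> \<bullet> u\<^sub>i)\<^sup>2)\<close>, where \<open>u\<^sub>i\<close> and \<open>y\<^sub>i\<close> are the first k - 1
  central coordinates and the last one of the i-th point (\<open>weighted_residual_sum\<close>). As
  \<open>\<bar>y\<^sub>i - \<beta>\<^sub>0 - \<beta> \<bullet> u\<^sub>i\<bar>\<close> is the distance from that point to the hyperplane along the last axis,
  \<open>R\<close> is also the directional moment that the best fit minimizes
  (\<open>directional_moment_graph_hyperplane\<close>).

  The quadratic form of \<open>K\<^sub>1\<close> is \<open>\<langle>K\<^sub>1\<beta>, \<beta>\<rangle> = (\<Sum>i. m\<^sub>i (\<beta> \<bullet> u\<^sub>i)\<^sup>2)\<close>. Its vanishing at some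
  \<open>\<beta> \<noteq> 0\<close> would put all points in a hyperplane parallel to the last axis, so it is positive
  definite (\<open>K1_pos_def\<close>), hence invertible. Completing the square with \<open>K\<^sub>1\<close>
  (\<open>complete_square\<close>) gives
  \<open>R (\<beta>\<^sub>0, \<beta>) = \<langle>K\<^sub>1(\<beta> - \<beta>'), \<beta> - \<beta>'\<rangle> + m \<beta>\<^sub>0\<^sup>2 + J\<^sub>k\<^sub>k - \<langle>K\<^sub>1\<^sup>-\<^sup>1b, b\<rangle>\<close> with \<open>\<beta>' = K\<^sub>1\<^sup>-\<^sup>1b\<close>.
  The rewritten equation and the unique minimizer \<open>(0, \<beta>')\<close> can be read off. So can the
  center of the level sets: a level set with two points has a positive level relative to the minimum
  and becomes an ellipsoid centered at \<open>(0, \<beta>')\<close> after division by that level. No other point is a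
  center, since a set with two centers of symmetry is invariant under a translation, whereas an
  ellipsoid contains no three equally spaced points on a line.
\<close>

section \<open>Splitting off the last coordinate\<close>

definition initial_coords :: "real ^ 'n option \<Rightarrow> real ^ ('n::finite)" where
  "initial_coords p = (\<chi> j. p $ Some j)"

lemma sum_UNIV_option:
  fixes f :: "'n::finite option \<Rightarrow> 'a::comm_monoid_add"
  shows "(\<Sum>j\<in>UNIV. f j) = f None + (\<Sum>j\<in>UNIV. f (Some j))"
  by (simp add: UNIV_option_conv sum.reindex)

lemma inner_option_split:
  fixes p q :: "real ^ ('n::finite) option"
  shows "p \<bullet> q = p $ None * q $ None + initial_coords p \<bullet> initial_coords q"
  by (simp add: inner_vec_def sum_UNIV_option initial_coords_def)

lemma linear_initial_coords: "linear initial_coords"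
  by (rule linearI) (simp_all add: initial_coords_def vec_eq_iff)

section \<open>The quadratic form as a weighted sum of squared residuals\<close>

abbreviation central_initial where
  "central_initial N m M i \<equiv> initial_coords (central_coords N m M i)"

abbreviation central_last where
  "central_last N m M i \<equiv> central_coords N m M i $ None"

lemma sum_mass_central_coords:
  assumes "total_mass N m \<noteq> 0"
  shows "(\<Sum>i=1..N. m i *\<^sub>R central_coords N m M i) = 0"
proof -
  have "(\<Sum>i=1..N. m i *\<^sub>R central_coords N m M i)
      = (\<Sum>i=1..N. m i *\<^sub>R M i) - total_mass N m *\<^sub>R mass_center N m M"
    by (simp add: central_coords_def scaleR_diff_right sum_subtractf total_mass_def
        scaleR_sum_left)
  also have "\<dots> = 0"
    using assms by (simp add: mass_center_def)
  finally show ?thesis .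
qed

lemma K1_mult:
  "K1 N m M *v \<beta> = (\<Sum>i=1..N. (m i * (central_initial N m M i \<bullet> \<beta>)) *\<^sub>R central_initial N m M i)"
proof -
  have "(K1 N m M *v \<beta>) $ j
      = (\<Sum>i=1..N. (m i * (central_initial N m M i \<bullet> \<beta>)) *\<^sub>R central_initial N m M i) $ j" for j
  proof -
    have "(K1 N m M *v \<beta>) $ j = (\<Sum>l\<in>UNIV. \<Sum>i=1..N.
        m i * central_coords N m M i $ Some j * central_coords N m M i $ Some l * \<beta> $ l)"
      by (simp add: matrix_vector_mult_def K1_def J_def sum_distrib_right)
    also have "\<dots> = (\<Sum>i=1..N. \<Sum>l\<in>UNIV.
        m i * central_coords N m M i $ Some j * central_coords N m M i $ Some l * \<beta> $ l)"
      by (rule sum.swap)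
    also have "\<dots>
        = (\<Sum>i=1..N. (m i * (central_initial N m M i \<bullet> \<beta>)) *\<^sub>R central_initial N m M i) $ j"
      by (simp add: inner_vec_def initial_coords_def sum_distrib_left sum_distrib_right mult_ac)
    finally show ?thesis .
  qed
  then show ?thesis
    by (simp add: vec_eq_iff)
qed

lemma K1_form:
  "(K1 N m M *v \<beta>) \<bullet> \<gamma>
     = (\<Sum>i=1..N. m i * (central_initial N m M i \<bullet> \<beta>) * (central_initial N m M i \<bullet> \<gamma>))"
  by (simp add: K1_mult inner_sum_left)

lemma K1_symmetric: "(K1 N m M *v \<beta>) \<bullet> \<gamma> = \<beta> \<bullet> (K1 N m M *v \<gamma>)"
  by (simp add: K1_form inner_commute[of \<beta>] mult_ac)

lemma b_vec_inner:
  "b_vec N m M \<bullet> \<beta> = (\<Sum>i=1..N. m i * central_last N m M i * (central_initial N m M i \<bullet> \<beta>))"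
proof -
  have "b_vec N m M = (\<Sum>i=1..N. (m i * central_last N m M i) *\<^sub>R central_initial N m M i)"
    by (simp add: vec_eq_iff b_vec_def J_def initial_coords_def mult_ac)
  then show ?thesis
    by (simp add: inner_sum_left)
qed

definition moment_form ::
  "nat \<Rightarrow> (nat \<Rightarrow> real) \<Rightarrow> (nat \<Rightarrow> real ^ 'n option) \<Rightarrow> real \<Rightarrow> real ^ ('n::finite) \<Rightarrow> real" where
  "moment_form N m M \<beta>\<^sub>0 \<beta> = (K1 N m M *v \<beta>) \<bullet> \<beta> - 2 * (b_vec N m M \<bullet> \<beta>)
     + total_mass N m * \<beta>\<^sub>0\<^sup>2 + J N m M None None"

text \<open>
  Expanding the squares produces the terms of \<open>moment_form\<close> together with two terms linear in
  \<open>\<beta>\<^sub>0\<close>; the latter carry the first moments of the central coordinates and vanish.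
\<close>

lemma weighted_residual_sum:
  assumes "total_mass N m \<noteq> 0"
  shows "(\<Sum>i=1..N. m i * (central_last N m M i - \<beta>\<^sub>0 - central_initial N m M i \<bullet> \<beta>)\<^sup>2)
     = moment_form N m M \<beta>\<^sub>0 \<beta>"
proof -
  define y where "y i = central_last N m M i" for i
  define w where "w i = central_initial N m M i \<bullet> \<beta>" for i
  have balance: "(\<Sum>i=1..N. m i *\<^sub>R central_coords N m M i) = 0"
    by (rule sum_mass_central_coords[OF assms])
  have last_balance: "(\<Sum>i=1..N. m i * y i) = 0"
    using arg_cong[OF balance, of "\<lambda>p. p $ None"] by (simp add: y_def)
  have initial_balance: "(\<Sum>i=1..N. m i * w i) = 0"
    using arg_cong[OF balance, of "\<lambda>p. initial_coords p \<bullet> \<beta>"]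
    by (simp add: w_def linear_sum[OF linear_initial_coords] linear_cmul[OF linear_initial_coords]
        linear_0[OF linear_initial_coords] inner_sum_left)
  have "(\<Sum>i=1..N. m i * (y i - \<beta>\<^sub>0 - w i)\<^sup>2)
      = (\<Sum>i=1..N. m i * w i * w i - 2 * (m i * y i * w i) + m i * \<beta>\<^sub>0\<^sup>2 + m i * y i * y i
          - 2 * \<beta>\<^sub>0 * (m i * y i) + 2 * \<beta>\<^sub>0 * (m i * w i))"
    by (rule sum.cong) (simp_all add: power2_eq_square algebra_simps)
  also have "\<dots> = (\<Sum>i=1..N. m i * w i * w i) - 2 * (\<Sum>i=1..N. m i * y i * w i)
      + (\<Sum>i=1..N. m i) * \<beta>\<^sub>0\<^sup>2 + (\<Sum>i=1..N. m i * y i * y i)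
      - 2 * \<beta>\<^sub>0 * (\<Sum>i=1..N. m i * y i) + 2 * \<beta>\<^sub>0 * (\<Sum>i=1..N. m i * w i)"
    by (simp add: sum.distrib sum_subtractf sum_distrib_left sum_distrib_right)
  also have "\<dots> = moment_form N m M \<beta>\<^sub>0 \<beta>"
    by (simp only: last_balance initial_balance)
      (simp add: moment_form_def K1_form b_vec_inner J_def total_mass_def y_def w_def)
  finally show ?thesis
    by (simp add: y_def w_def)
qed

section \<open>The directional moment of a hyperplane\<close>

text \<open>
  Moving along the last axis changes only the last coordinate, so a line of this direction
  meets the hyperplane where the displacement equals the signed residual.
\<close>

lemma directional_dist_graph_hyperplane:
  "directional_dist (graph_hyperplane C \<beta>\<^sub>0 \<beta>) p
     = \<bar>(p - C) $ None - \<beta>\<^sub>0 - initial_coords (p - C) \<bullet> \<beta>\<bar>"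
proof -
  define t where "t = \<beta>\<^sub>0 + initial_coords (p - C) \<bullet> \<beta> - (p - C) $ None"
  have "p + s *\<^sub>R axis None 1 \<in> graph_hyperplane C \<beta>\<^sub>0 \<beta> \<longleftrightarrow> s = t" for s
    by (auto simp: graph_hyperplane_def t_def inner_vec_def initial_coords_def axis_def mult.commute)
  then have "graph_hyperplane C \<beta>\<^sub>0 \<beta> \<inter> last_axis_line p = {p + t *\<^sub>R axis None 1}"
    by (auto simp: last_axis_line_def)
  then show ?thesis
    by (simp add: directional_dist_def dist_norm t_def norm_axis_1 abs_if)
qed

lemma directional_moment_graph_hyperplane:
  assumes "total_mass N m \<noteq> 0"
  shows "directional_moment N m M (graph_hyperplane (mass_center N m M) \<beta>\<^sub>0 \<beta>)
     = moment_form N m M \<beta>\<^sub>0 \<beta>"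
  by (simp add: directional_moment_def directional_dist_graph_hyperplane
      weighted_residual_sum[OF assms, symmetric] central_coords_def)

section \<open>Positive definiteness and completion of the square\<close>

lemma total_mass_pos:
  fixes M :: "nat \<Rightarrow> real ^ ('n::finite) option"
  assumes "\<forall>i\<in>{1..N}. m i > 0"
    and "\<not> (\<exists>a c. a \<noteq> 0 \<and> (\<forall>i\<in>{1..N}. M i \<in> {x. a \<bullet> x = c}))"
  shows "total_mass N m > 0"
proof -
  \<comment> \<open>Without any point, every hyperplane would contain the configuration.\<close>
  have "N \<noteq> 0"
  proof
    assume "N = 0"
    moreover have "(axis None 1 :: real ^ 'n option) \<noteq> 0"
      by (simp add: axis_eq_0_iff)
    ultimately show False
      using assms(2) by auto
  qed
  then show ?thesis
    unfolding total_mass_def using assms(1) by (intro sum_pos) auto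
qed

text \<open>
  If \<open>\<langle>K\<^sub>1\<beta>, \<beta>\<rangle> = 0\<close>, then every \<open>\<beta> \<bullet> u\<^sub>i\<close> vanishes, and the hyperplane through the center of
  masses with normal vector \<open>(\<beta>, 0)\<close> contains all points.
\<close>

lemma K1_pos_def:
  fixes M :: "nat \<Rightarrow> real ^ ('n::finite) option"
  assumes masses_pos: "\<forall>i\<in>{1..N}. m i > 0"
    and not_in_hyperplane: "\<not> (\<exists>a c. a \<noteq> 0 \<and> (\<forall>i\<in>{1..N}. M i \<in> {x. a \<bullet> x = c}))"
    and "\<beta> \<noteq> 0"
  shows "(K1 N m M *v \<beta>) \<bullet> \<beta> > 0"
proof (rule ccontr)
  assume not_pos: "\<not> (K1 N m M *v \<beta>) \<bullet> \<beta> > 0"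
  have nonneg: "0 \<le> m i * (central_initial N m M i \<bullet> \<beta>) * (central_initial N m M i \<bullet> \<beta>)"
    if "i \<in> {1..N}" for i
    using bspec[OF masses_pos that] by (simp add: mult.assoc)
  have "(\<Sum>i=1..N. m i * (central_initial N m M i \<bullet> \<beta>) * (central_initial N m M i \<bullet> \<beta>)) = 0"
    using not_pos unfolding K1_form not_less by (intro antisym sum_nonneg nonneg)
  then have "\<forall>i\<in>{1..N}. m i * (central_initial N m M i \<bullet> \<beta>) * (central_initial N m M i \<bullet> \<beta>) = 0"
    by (subst (asm) sum_nonneg_eq_0_iff) (use nonneg in auto)
  then have orthogonal: "central_initial N m M i \<bullet> \<beta> = 0" if "i \<in> {1..N}" for i
    using masses_pos that by force
  define a :: "real ^ 'n option" where
    "a = (\<chi> j. case j of None \<Rightarrow> 0 | Some l \<Rightarrow> \<beta> $ l)"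
  have a_None: "a $ None = 0" and a_initial: "initial_coords a = \<beta>"
    by (simp_all add: a_def initial_coords_def vec_eq_iff)
  have "a \<noteq> 0"
    using \<open>\<beta> \<noteq> 0\<close> a_initial linear_0[OF linear_initial_coords] by auto
  moreover have "a \<bullet> M i = a \<bullet> mass_center N m M" if "i \<in> {1..N}" for i
  proof -
    have "a \<bullet> central_coords N m M i = 0"
      using orthogonal[OF that] by (simp add: inner_option_split a_None a_initial inner_commute)
    then show ?thesis
      by (simp add: central_coords_def inner_diff_right)
  qed
  ultimately show False
    using not_in_hyperplane by blast
qed

lemma invertible_if_pos_def:
  fixes A :: "real ^ 'n ^ 'n"
  assumes "\<And>x. x \<noteq> 0 \<Longrightarrow> (A *v x) \<bullet> x > 0"
  shows "invertible A"
proof -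
  have "x = 0" if "A *v x = 0" for x
    using assms[of x] that by force
  then show ?thesis
    by (meson invertible_left_inverse matrix_left_invertible_ker)
qed

lemma matrix_vector_mul_inv:
  fixes A :: "real ^ 'n ^ 'n"
  assumes "invertible A"
  shows "A *v (matrix_inv A *v x) = x"
  using someI_ex[OF assms[unfolded invertible_def]]
  by (simp add: matrix_vector_mul_assoc matrix_inv_def)

lemma complete_square:
  fixes A :: "real ^ 'n ^ 'n" and b :: "real ^ 'n"
  assumes "invertible A" and symmetric: "\<And>x y. (A *v x) \<bullet> y = x \<bullet> (A *v y)"
  defines "z \<equiv> matrix_inv A *v b"
  shows "(A *v x) \<bullet> x - 2 * (b \<bullet> x) = (A *v (x - z)) \<bullet> (x - z) - z \<bullet> b"
proof -
  have Az: "A *v z = b"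
    unfolding z_def by (rule matrix_vector_mul_inv[OF assms(1)])
  have "(A *v x) \<bullet> z = b \<bullet> x"
    by (simp add: symmetric Az inner_commute[of b])
  then show ?thesis
    by (simp add: matrix_vector_mult_diff_distrib Az inner_diff_left inner_diff_right
        inner_commute[of z b])
qed

lemma moment_form_centered:
  assumes "invertible (K1 N m M)"
  shows "moment_form N m M \<beta>\<^sub>0 \<beta>
     = (K1 N m M *v (\<beta> - beta_hat N m M)) \<bullet> (\<beta> - beta_hat N m M) + total_mass N m * \<beta>\<^sub>0\<^sup>2
       + J N m M None None - (matrix_inv (K1 N m M) *v b_vec N m M) \<bullet> b_vec N m M"
  using complete_square[OF assms K1_symmetric, where b = "b_vec N m M" and x = \<beta>]
  by (simp add: moment_form_def beta_hat_def)

section \<open>Centers of ellipsoids\<close>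

text \<open>
  A form that equals 1 at \<open>x\<close>, \<open>x + v\<close> and \<open>x + 2v\<close> has vanishing second difference there,
  which is twice its value at \<open>v\<close>.
\<close>

lemma ellipsoid_no_three_equally_spaced:
  assumes "ellipsoid_with_center c E" "x \<in> E" "x + v \<in> E" "x + 2 *\<^sub>R v \<in> E"
  shows "v = 0"
proof (rule ccontr)
  assume "v \<noteq> 0"
  from assms(1) obtain f where f: "linear f" "\<And>x. x \<noteq> 0 \<Longrightarrow> f x \<bullet> x > 0"
    and E: "E = {x. f (x - c) \<bullet> (x - c) = 1}"
    unfolding ellipsoid_with_center_def by blast
  define u where "u = x - c"
  have "f u \<bullet> u = 1" "f (u + v) \<bullet> (u + v) = 1" "f (u + 2 *\<^sub>R v) \<bullet> (u + 2 *\<^sub>R v) = 1"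
    using assms(2-4) by (auto simp: E u_def algebra_simps)
  then have "f v \<bullet> v = 0"
    by (simp add: linear_add[OF f(1)] linear_cmul[OF f(1)] inner_add_left inner_add_right)
  then show False
    using f(2)[OF \<open>v \<noteq> 0\<close>] by simp
qed

lemma ellipsoid_reflection:
  assumes "ellipsoid_with_center c E" "x \<in> E"
  shows "2 *\<^sub>R c - x \<in> E"
proof -
  from assms(1) obtain f where f: "linear f" and E: "E = {x. f (x - c) \<bullet> (x - c) = 1}"
    unfolding ellipsoid_with_center_def by blast
  have "2 *\<^sub>R c - x - c = - (x - c)"
    by (simp add: scaleR_2)
  moreover have "f (- (x - c)) \<bullet> (- (x - c)) = f (x - c) \<bullet> (x - c)"
    by (simp only: linear_neg[OF f] inner_minus_left inner_minus_right minus_minus)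
  ultimately show ?thesis
    using assms(2) by (simp only: E mem_Collect_eq)
qed

text \<open>
  The reflections in two centers compose to a translation, which would carry a point of the
  ellipsoid to further, equally spaced points of it.
\<close>

lemma ellipsoid_center_unique:
  assumes c: "ellipsoid_with_center c E" and d: "ellipsoid_with_center d E" and "x \<in> E"
  shows "c = d"
proof -
  define v where "v = 2 *\<^sub>R (d - c)"
  have translate: "y + v \<in> E" if "y \<in> E" for y
    using ellipsoid_reflection[OF d ellipsoid_reflection[OF c that]]
    by (simp add: v_def algebra_simps)
  have "x + v \<in> E" "x + v + v \<in> E"
    using translate \<open>x \<in> E\<close> by blast+
  then have "v = 0"
    using ellipsoid_no_three_equally_spaced[OF c \<open>x \<in> E\<close>] by (simp add: scaleR_2 add.assoc)
  then show ?thesis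
    by (simp add: v_def)
qed

lemma pos_def_level_set_ellipsoid:
  fixes F :: "'a::euclidean_space \<Rightarrow> 'a"
  assumes F: "linear F" "\<And>x y. F x \<bullet> y = x \<bullet> F y" "\<And>x. x \<noteq> 0 \<Longrightarrow> F x \<bullet> x > 0"
    and "\<nu> > 0"
  shows "ellipsoid_with_center c {x. F (x - c) \<bullet> (x - c) = \<nu>}"
  unfolding ellipsoid_with_center_def
proof (intro exI[of _ "\<lambda>x. (1 / \<nu>) *\<^sub>R F x"] conjI allI impI)
  show "linear (\<lambda>x. (1 / \<nu>) *\<^sub>R F x)"
    using F(1) by (rule linear_compose_scale_right)
  show "(1 / \<nu>) *\<^sub>R F x \<bullet> y = x \<bullet> (1 / \<nu>) *\<^sub>R F y" for x y
    by (simp add: F(2))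
  show "(1 / \<nu>) *\<^sub>R F x \<bullet> x > 0" if "x \<noteq> 0" for x
    using F(3)[OF that] \<open>\<nu> > 0\<close> by simp
  show "{x. F (x - c) \<bullet> (x - c) = \<nu>} = {x. (1 / \<nu>) *\<^sub>R F (x - c) \<bullet> (x - c) = 1}"
    using \<open>\<nu> > 0\<close> by (auto simp: field_simps)
qed

text \<open>
  At a level below zero the level set is empty and at zero it is the center alone, so two
  points force a positive level.
\<close>

lemma pos_def_level_set_center_iff:
  fixes F :: "'a::euclidean_space \<Rightarrow> 'a"
  assumes F: "linear F" "\<And>x y. F x \<bullet> y = x \<bullet> F y" "\<And>x. x \<noteq> 0 \<Longrightarrow> F x \<bullet> x > 0"
    and two_points: "p \<in> {x. F (x - d) \<bullet> (x - d) = \<nu>}" "q \<in> {x. F (x - d) \<bullet> (x - d) = \<nu>}" "p \<noteq> q"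
  shows "ellipsoid_with_center c {x. F (x - d) \<bullet> (x - d) = \<nu>} \<longleftrightarrow> c = d"
proof -
  from \<open>p \<noteq> q\<close> consider "p - d \<noteq> 0" | "q - d \<noteq> 0"
    by fastforce
  then have "\<nu> > 0"
    using F(3)[of "p - d"] F(3)[of "q - d"] two_points by cases auto
  then have "ellipsoid_with_center d {x. F (x - d) \<bullet> (x - d) = \<nu>}"
    using F by (intro pos_def_level_set_ellipsoid)
  then show ?thesis
    using ellipsoid_center_unique two_points(1) by blast
qed

section \<open>The center of the family and the best fit hyperplane\<close>

theorem proposition5p4:
  fixes N :: nat and m :: "nat \<Rightarrow> real" and M :: "nat \<Rightarrow> real ^ ('n::finite) option"
  assumes masses_pos: "\<forall>i\<in>{1..N}. m i > 0"
    and not_in_hyperplane: "\<not> (\<exists>a c. a \<noteq> 0 \<and> (\<forall>i\<in>{1..N}. M i \<in> {x. a \<bullet> x = c}))"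
  shows "invertible (K1 N m M) \<and>
         (\<forall>\<mu>. (\<exists>p\<in>family N m M \<mu>. \<exists>q\<in>family N m M \<mu>. p \<noteq> q) \<longrightarrow>
           (\<forall>c. ellipsoid_with_center c (family N m M \<mu>) \<longleftrightarrow> c = (0, beta_hat N m M))) \<and>
         (\<forall>\<beta>\<^sub>0 \<beta>. best_fit_hyperplane N m M (graph_hyperplane (mass_center N m M) \<beta>\<^sub>0 \<beta>)
           \<longleftrightarrow> (\<beta>\<^sub>0, \<beta>) = (0, beta_hat N m M)) \<and>
         (\<forall>\<mu>. family N m M \<mu> =
           {(\<beta>\<^sub>0, \<beta>). (K1 N m M *v (\<beta> - beta_hat N m M)) \<bullet> (\<beta> - beta_hat N m M)
              = \<mu> + (matrix_inv (K1 N m M) *v b_vec N m M) \<bullet> b_vec N m M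
                - total_mass N m * \<beta>\<^sub>0\<^sup>2 - J N m M None None})"
proof (intro conjI allI impI)
  have mass: "total_mass N m > 0"
    using total_mass_pos assms by blast
  have pos: "(K1 N m M *v \<beta>) \<bullet> \<beta> > 0" if "\<beta> \<noteq> 0" for \<beta>
    using K1_pos_def assms that by blast
  show inv: "invertible (K1 N m M)"
    using pos by (rule invertible_if_pos_def)
  note centered = moment_form_centered[OF inv]
  \<comment> \<open>One operator on the whole parameter space, block diagonal because the centering of the
    masses leaves no mixed terms in \<open>\<beta>\<^sub>0\<close> and \<open>\<beta>\<close>.\<close>
  define F where "F = (\<lambda>(\<beta>\<^sub>0, \<beta>). (total_mass N m * \<beta>\<^sub>0, K1 N m M *v \<beta>))"
  have F_form: "F p \<bullet> p = (K1 N m M *v snd p) \<bullet> snd p + total_mass N m * (fst p)\<^sup>2" for p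
    by (simp add: F_def case_prod_unfold inner_prod_def power2_eq_square)
  have F_linear: "linear F"
    unfolding F_def by (rule linearI)
      (auto simp: matrix_vector_right_distrib matrix_vector_mult_scaleR algebra_simps)
  have F_symmetric: "F p \<bullet> q = p \<bullet> F q" for p q
    by (simp add: F_def case_prod_unfold inner_prod_def K1_symmetric)
  have F_pos: "F p \<bullet> p > 0" if "p \<noteq> 0" for p
  proof (cases "snd p = 0")
    case True
    then have "fst p \<noteq> 0"
      using that by (metis prod_eqI fst_zero snd_zero)
    then show ?thesis
      using True mass by (simp add: F_form)
  next
    case False
    then show ?thesis
      using pos mass by (simp add: F_form add_pos_nonneg)
  qed
  define \<rho> where
    "\<rho> = J N m M None None - (matrix_inv (K1 N m M) *v b_vec N m M) \<bullet> b_vec N m M"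
  let ?c = "(0, beta_hat N m M)"
  have form_F: "moment_form N m M \<beta>\<^sub>0 \<beta> = F ((\<beta>\<^sub>0, \<beta>) - ?c) \<bullet> ((\<beta>\<^sub>0, \<beta>) - ?c) + \<rho>" for \<beta>\<^sub>0 \<beta>
    by (simp add: centered F_form \<rho>_def)
  have family_F: "family N m M \<mu> = {p. F (p - ?c) \<bullet> (p - ?c) = \<mu> - \<rho>}" for \<mu>
    by (auto simp: family_def moment_form_def[symmetric] form_F)

  show "ellipsoid_with_center c (family N m M \<mu>) \<longleftrightarrow> c = ?c"
    if "\<exists>p\<in>family N m M \<mu>. \<exists>q\<in>family N m M \<mu>. p \<noteq> q" for \<mu> c
    using pos_def_level_set_center_iff[OF F_linear F_symmetric F_pos] that
    unfolding family_F by blast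

  show "best_fit_hyperplane N m M (graph_hyperplane (mass_center N m M) \<beta>\<^sub>0 \<beta>)
      \<longleftrightarrow> (\<beta>\<^sub>0, \<beta>) = ?c" for \<beta>\<^sub>0 \<beta>
  proof -
    have "best_fit_hyperplane N m M (graph_hyperplane (mass_center N m M) \<beta>\<^sub>0 \<beta>)
        \<longleftrightarrow> (\<forall>\<gamma>\<^sub>0 \<gamma>. moment_form N m M \<beta>\<^sub>0 \<beta> \<le> moment_form N m M \<gamma>\<^sub>0 \<gamma>)"
      using directional_moment_graph_hyperplane[of N m M] mass
      by (auto simp: best_fit_hyperplane_def) metis
    also have "\<dots> \<longleftrightarrow> (\<beta>\<^sub>0, \<beta>) = ?c"
    proof
      assume "\<forall>\<gamma>\<^sub>0 \<gamma>. moment_form N m M \<beta>\<^sub>0 \<beta> \<le> moment_form N m M \<gamma>\<^sub>0 \<gamma>"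
      then have "moment_form N m M \<beta>\<^sub>0 \<beta> \<le> moment_form N m M 0 (beta_hat N m M)"
        by blast
      then have "F ((\<beta>\<^sub>0, \<beta>) - ?c) \<bullet> ((\<beta>\<^sub>0, \<beta>) - ?c) \<le> 0"
        by (simp add: form_F)
      then show "(\<beta>\<^sub>0, \<beta>) = ?c"
        using F_pos[of "(\<beta>\<^sub>0, \<beta>) - ?c"] by (metis eq_iff_diff_eq_0 not_less)
    next
      assume "(\<beta>\<^sub>0, \<beta>) = ?c"
      moreover have "F p \<bullet> p \<ge> 0" for p
        using F_pos[of p] by (cases "p = 0") (auto simp: less_imp_le)
      ultimately show "\<forall>\<gamma>\<^sub>0 \<gamma>. moment_form N m M \<beta>\<^sub>0 \<beta> \<le> moment_form N m M \<gamma>\<^sub>0 \<gamma>"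
        by (simp add: form_F del: diff_Pair)
    qed
    finally show ?thesis .
  qed

  show "family N m M \<mu> =
      {(\<beta>\<^sub>0, \<beta>). (K1 N m M *v (\<beta> - beta_hat N m M)) \<bullet> (\<beta> - beta_hat N m M)
         = \<mu> + (matrix_inv (K1 N m M) *v b_vec N m M) \<bullet> b_vec N m M
           - total_mass N m * \<beta>\<^sub>0\<^sup>2 - J N m M None None}" for \<mu>
    by (auto simp: family_def moment_form_def[symmetric] centered)
qed

end
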